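(* There are positive constants $c$ and $n_0$ such that for every $n\geq n_0$ there exists a tree $T_n$ with $n$ vertices and maximum degree $\Delta(T_n)<\left(\frac12-c\right)n$ such that Client has a winning strategy in the game $\mathrm{WC}(n,T_n)$.
   Context: The unbiased Waiter-Client game $\mathrm{WC}(n,T_n)$ is played on the edge set of the complete graph $K_n$. In each round Waiter offers Client two previously unclaimed edges; Client chooses one of them, which he keeps (colored red), and the other goes to Waiter (colored blue). If in the final round only one unclaimed edge remains, it goes to Waiter. Waiter wins if at the end Client's (red) graph contains a copy of the tree $T_n$; otherwise Client wins. *)

theory Defs
  imports Complex_Main
begin

definition is_graph :: "'a set \<Rightarrow> 'a set set \<Rightarrow> bool" where
  "is_graph V E \<longleftrightarrow> finite V \<and> (\<forall>e\<in>E. e \<subseteq> V \<and> card e = 2)"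

definition adj :: "'a set set \<Rightarrow> 'a \<Rightarrow> 'a \<Rightarrow> bool" where
  "adj E u v \<longleftrightarrow> u \<noteq> v \<and> {u, v} \<in> E"

definition connected_graph :: "'a set \<Rightarrow> 'a set set \<Rightarrow> bool" where
  "connected_graph V E \<longleftrightarrow> (\<forall>u\<in>V. \<forall>v\<in>V. (adj E)\<^sup>*\<^sup>* u v)"

definition has_cycle :: "'a set set \<Rightarrow> bool" where
  "has_cycle E \<longleftrightarrow> (\<exists>vs. length vs \<ge> 3 \<and> distinct vs
      \<and> (\<forall>i. Suc i < length vs \<longrightarrow> adj E (vs ! i) (vs ! Suc i))
      \<and> adj E (last vs) (hd vs))"

definition is_tree :: "'a set \<Rightarrow> 'a set set \<Rightarrow> bool" where
  "is_tree V E \<longleftrightarrow> is_graph V E \<and> V \<noteq> {} \<and> connected_graph V E \<and> \<not> has_cycle E"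

definition degree :: "'a set set \<Rightarrow> 'a \<Rightarrow> nat" where
  "degree E v = card {e \<in> E. v \<in> e}"

definition Kn_edges :: "nat \<Rightarrow> nat set set" where
  "Kn_edges n = {{u, v} | u v. u < n \<and> v < n \<and> u \<noteq> v}"

definition contains_copy :: "nat set set \<Rightarrow> 'a set \<Rightarrow> 'a set set \<Rightarrow> bool" where
  "contains_copy R VT ET \<longleftrightarrow> (\<exists>f. inj_on f VT \<and> (\<forall>u\<in>VT. \<forall>v\<in>VT. {u, v} \<in> ET \<longrightarrow> {f u, f v} \<in> R))"

text \<open>Waiter-Client game on the edge set Eb: position (R, B) = Client's (red) and Waiter's (blue)
  edges so far. Client wins from a position if he has a strategy guaranteeing that at the end
  his red graph does not satisfy the target property P.  With at most one unclaimed edge the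
  game ends (the last edge, if any, goes to Waiter).  Otherwise Waiter offers two distinct
  unclaimed edges e1, e2 and Client keeps one of them.  Since the game is finite, the least
  fixed point below is exactly the set of positions from which Client has a winning strategy.\<close>
inductive client_wins :: "'e set \<Rightarrow> ('e set \<Rightarrow> bool) \<Rightarrow> 'e set \<Rightarrow> 'e set \<Rightarrow> bool"
  for Eb :: "'e set" and P :: "'e set \<Rightarrow> bool" where
  finish: "card (Eb - R - B) \<le> 1 \<Longrightarrow> finite (Eb - R - B) \<Longrightarrow> \<not> P R \<Longrightarrow> client_wins Eb P R B"
| step: "card (Eb - R - B) \<ge> 2 \<Longrightarrow>
     (\<forall>e1 \<in> Eb - R - B. \<forall>e2 \<in> Eb - R - B. e1 \<noteq> e2 \<longrightarrow>
        client_wins Eb P (insert e1 R) (insert e2 B) \<or> client_wins Eb P (insert e2 R) (insert e1 B))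
     \<Longrightarrow> client_wins Eb P R B"

definition client_wins_WC :: "nat \<Rightarrow> 'a set \<Rightarrow> 'a set set \<Rightarrow> bool" where
  "client_wins_WC n VT ET \<longleftrightarrow> client_wins (Kn_edges n) (\<lambda>R. contains_copy R VT ET) {} {}"

end

theory Submission
  imports Defs "HOL-Real_Asymp.Real_Asymp"
begin

text \<open>
  The tree has two adjacent centres carrying almost half of the vertices as leaves each; the few
  remaining vertices hang on a third vertex. Imagine that Client chooses at random, keeping the
  offered edge with the smaller sum of endpoints with probability \<open>3/4\<close>. Fix \<open>a < b\<close>. If Waiter offers
  \<open>va\<close> and \<open>vb\<close> together for most \<open>v\<close>, then this bias makes the red degree of \<open>b\<close> too small for
  a centre; otherwise a positive proportion of the vertices is joined in red to neither \<open>a\<close> nor \<open>b\<close>.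
  Both cases are captured by one quantity, (red degree of \<open>b\<close>) - 8 (number of \<open>v\<close> with neither
  \<open>va\<close> nor \<open>vb\<close> red), whose expectation is at most about \<open>n/4\<close> whatever Waiter does, whereas a
  copy of the tree with centres \<open>a\<close>, \<open>b\<close> makes it almost \<open>n/2\<close>. Summing exponentials of the
  conditional expectations over all pairs derandomises the strategy.
\<close>

section \<open>Trees given by a parent function\<close>

text \<open>Listing edges as child-parent pairs makes connectedness and acyclicity follow from
  \<open>p i < i\<close> alone.\<close>

definition parent_edges :: "(nat \<Rightarrow> nat) \<Rightarrow> nat \<Rightarrow> nat set set" where
  "parent_edges p n = (\<lambda>i. {i, p i}) ` {1..<n}"

context
  fixes p :: "nat \<Rightarrow> nat" and n :: nat
  assumes parent_less: "\<And>i. 1 \<le> i \<Longrightarrow> i < n \<Longrightarrow> p i < i"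
begin

lemma adj_parent:
  assumes "1 \<le> i" "i < n"
  shows "adj (parent_edges p n) i (p i)"
  using parent_less[OF assms] assms by (auto simp: adj_def parent_edges_def)

text \<open>Each edge joins a vertex to its smaller parent, so a vertex has at most one smaller
  neighbour.\<close>

lemma adj_parent_edges_less:
  assumes "adj (parent_edges p n) u v" "u < v"
  shows "u = p v"
  using assms parent_less by (fastforce simp: adj_def parent_edges_def doubleton_eq_iff)

lemma connected_parent_edges: "connected_graph {..<n} (parent_edges p n)"
proof -
  let ?A = "adj (parent_edges p n)"
  have symA: "symp ?A" by (auto simp: symp_def adj_def insert_commute)
  have root: "?A\<^sup>*\<^sup>* i 0" if "i < n" for i
    using that
  proof (induction i rule: less_induct)
    case (less i)
    show ?case
    proof (cases "i = 0")
      case False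
      with less.prems have "?A i (p i)" "p i < i"
        using adj_parent[of i] parent_less[of i] by auto
      with less show ?thesis by (meson converse_rtranclp_into_rtranclp less_trans)
    qed simp
  qed
  have "?A\<^sup>*\<^sup>* 0 i" if "i < n" for i
    using root[OF that] symA by (metis symp_rtranclp sympD)
  with root show ?thesis
    unfolding connected_graph_def by (metis lessThan_iff rtranclp_trans)
qed

text \<open>The largest vertex of a cycle would have two distinct smaller neighbours.\<close>

lemma no_cycle_parent_edges: "\<not> has_cycle (parent_edges p n)"
proof
  let ?A = "adj (parent_edges p n)"
  assume "has_cycle (parent_edges p n)"
  then obtain vs where l: "length vs \<ge> 3" and d: "distinct vs"
    and step: "\<And>i. Suc i < length vs \<Longrightarrow> ?A (vs ! i) (vs ! Suc i)"
    and wrap: "?A (last vs) (hd vs)"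
    unfolding has_cycle_def by blast
  let ?l = "length vs"
  have ne: "vs \<noteq> []" using l by auto
  have cyc: "?A (vs ! i) (vs ! (Suc i mod ?l))" if "i < ?l" for i
  proof (cases "Suc i < ?l")
    case False
    with that have "Suc i = ?l" by simp
    with wrap ne show ?thesis by (metis diff_Suc_1 hd_conv_nth last_conv_nth mod_self)
  qed (use step in simp)
  obtain j where j: "j < ?l" "vs ! j = Max (set vs)"
    using ne by (metis List.finite_set Max_in in_set_conv_nth set_empty)
  have smaller: "vs ! i < vs ! j" if "i < ?l" "i \<noteq> j" for i
    using that j d
    by (metis List.finite_set Max_ge le_neq_implies_less nth_eq_iff_index_eq nth_mem)
  \<comment> \<open>\<open>k\<close> and \<open>k'\<close> are the cyclic neighbours of the position
    \<open>j\<close> of the maximum; length at least 3 keeps them distinct.\<close>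
  define k where "k = (if j = 0 then ?l - 1 else j - 1)"
  define k' where "k' = Suc j mod ?l"
  have k: "k < ?l" "k \<noteq> j" "Suc k mod ?l = j" using j l by (auto simp: k_def)
  have k': "k' < ?l" "k' \<noteq> j" "k' \<noteq> k"
    using j l by (auto simp: k'_def k_def mod_Suc)
  have "vs ! k = p (vs ! j)"
    using cyc[OF k(1)] k smaller by (intro adj_parent_edges_less) auto
  moreover have "?A (vs ! k') (vs ! j)"
    using cyc[OF j(1)] by (auto simp: k'_def adj_def insert_commute)
  then have "vs ! k' = p (vs ! j)"
    using k' smaller by (intro adj_parent_edges_less) auto
  ultimately show False
    using k k' d by (metis nth_eq_iff_index_eq)
qed

lemma is_tree_parent_edges:
  assumes "n > 0"
  shows "is_tree {..<n} (parent_edges p n)"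
proof -
  have "is_graph {..<n} (parent_edges p n)"
    using parent_less by (fastforce simp: is_graph_def parent_edges_def card_insert_if)
  with assms show ?thesis
    using connected_parent_edges no_cycle_parent_edges by (auto simp: is_tree_def)
qed

text \<open>\<open>Suc\<close> accounts for the edge from \<open>v\<close> to its own parent; all
  other edges at \<open>v\<close> come from children.\<close>

lemma degree_parent_edges_le:
  "degree (parent_edges p n) v \<le> Suc (card {i \<in> {1..<n}. p i = v})"
proof -
  have "{e \<in> parent_edges p n. v \<in> e} \<subseteq> (\<lambda>i. {i, p i}) ` insert v {i \<in> {1..<n}. p i = v}"
    by (auto simp: parent_edges_def)
  then have "degree (parent_edges p n) v \<le> card (insert v {i \<in> {1..<n}. p i = v})"
    unfolding degree_def by (rule surj_card_le[rotated]) simp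
  also have "\<dots> \<le> Suc (card {i \<in> {1..<n}. p i = v})"
    by (rule card_insert_le_m1[THEN order_trans]) auto
  finally show ?thesis .
qed

end

section \<open>Client's potential function\<close>

datatype colour = Free | Red | Blue

definition colour_of :: "'e set \<Rightarrow> 'e set \<Rightarrow> 'e \<Rightarrow> colour" where
  "colour_of R B e = (if e \<in> R then Red else if e \<in> B then Blue else Free)"

lemma colour_of_cong:
  assumes "R' - {e1, e2} = R - {e1, e2}" "B' - {e1, e2} = B - {e1, e2}" "e1 \<noteq> e" "e2 \<noteq> e"
  shows "colour_of R' B' e = colour_of R B e"
proof -
  have "e \<in> R' \<longleftrightarrow> e \<in> R" "e \<in> B' \<longleftrightarrow> e \<in> B" using assms by blast+
  then show ?thesis by (simp add: colour_of_def)
qed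

text \<open>
  For the colours of \<open>va\<close> and \<open>vb\<close>, this is 32 times the largest conditional expectation of
  [\<open>vb\<close> red] - 8 [neither red] that Waiter can achieve when every edge is red with probability
  between \<open>1/4\<close> and \<open>3/4\<close>, plus 1 for every free edge. The extra 1 produces the negative
  drift that absorbs the second-order terms of the exponential.
\<close>

fun val :: "colour \<Rightarrow> colour \<Rightarrow> real" where
  "val Free Free = 10"
| "val Free Red = 33"
| "val Free Blue = -63"
| "val Red Free = 25"
| "val Red Red = 32"
| "val Red Blue = 0"
| "val Blue Free = -39"
| "val Blue Red = 32"
| "val Blue Blue = -256"

lemma val_bounds: "-256 \<le> val x y" "val x y \<le> 33"
  by (cases x; cases y; simp)+

lemma val_Red_right: "32 \<le> val x y" if "y = Red"
  using that by (cases x) auto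

lemma val_Red_left: "0 \<le> val x y" if "x = Red"
  using that by (cases y) auto

definition pair_val :: "nat \<Rightarrow> nat set set \<Rightarrow> nat set set \<Rightarrow> nat \<Rightarrow> nat \<Rightarrow> real" where
  "pair_val n R B a b =
    (\<Sum>v\<in>{..<n} - {a, b}. val (colour_of R B {v, a}) (colour_of R B {v, b}))"

definition vertex_pairs :: "nat \<Rightarrow> (nat \<times> nat) set" where
  "vertex_pairs n = {(a, b). a < b \<and> b < n}"

definition potential :: "nat \<Rightarrow> nat set set \<Rightarrow> nat set set \<Rightarrow> real" where
  "potential n R B = (\<Sum>(a, b)\<in>vertex_pairs n. exp (pair_val n R B a b / 3000000))"

lemma vertex_pairs_subset: "vertex_pairs n \<subseteq> {..<n} \<times> {..<n}"
  by (auto simp: vertex_pairs_def)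

lemma finite_vertex_pairs: "finite (vertex_pairs n)"
  using vertex_pairs_subset by (rule finite_subset) simp

lemma potential_start: "potential n {} {} \<le> real n ^ 2 * exp (10 * real n / 3000000)"
proof -
  have "exp (pair_val n {} {} a b / 3000000) \<le> exp (10 * real n / 3000000)" for a b
  proof -
    have "card ({..<n} - {a, b}) \<le> n"
      using card_mono[of "{..<n}" "{..<n} - {a, b}"] by auto
    then show ?thesis by (simp add: pair_val_def colour_of_def)
  qed
  then have "potential n {} {} \<le> real (card (vertex_pairs n)) * exp (10 * real n / 3000000)"
    unfolding potential_def by (intro sum_bounded_above) auto
  moreover have "card (vertex_pairs n) \<le> n * n"
    using card_mono[OF _ vertex_pairs_subset] by (simp add: card_cartesian_product)
  then have "real (card (vertex_pairs n)) \<le> real n ^ 2"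
    by (metis of_nat_le_iff of_nat_mult power2_eq_square)
  ultimately show ?thesis
    by (meson exp_ge_zero mult_right_mono order_trans)
qed

section \<open>Expected change of the potential in one round\<close>

text \<open>After multiplication by \<open>1 - x > 0\<close>, the left side is at most 1 because
  \<open>1 - x \<le> exp (- x)\<close>, and the right side is
  \<open>1 + x\<^sup>2 * (1 - 2 * x) \<ge> 1\<close>.\<close>

lemma exp_le_quadratic:
  fixes x :: real
  assumes "\<bar>x\<bar> \<le> 1/2"
  shows "exp x \<le> 1 + x + 2 * x\<^sup>2"
proof -
  have "1 - x \<le> exp (- x)" using exp_ge_add_one_self[of "-x"] by simp
  then have "(1 - x) * exp x \<le> 1"
    by (metis exp_ge_zero exp_minus_inverse mult.commute mult_right_mono)
  also have "1 \<le> (1 - x) * (1 + x + 2 * x\<^sup>2)"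
  proof -
    have "(1 - x) * (1 + x + 2 * x\<^sup>2) = 1 + x\<^sup>2 * (1 - 2 * x)"
      by (simp add: algebra_simps power2_eq_square)
    moreover have "0 \<le> x\<^sup>2 * (1 - 2 * x)" using assms by (intro mult_nonneg_nonneg) auto
    ultimately show ?thesis by simp
  qed
  finally show ?thesis by (rule mult_left_le_imp_le) (use assms in linarith)
qed

text \<open>When \<open>va\<close> and \<open>vb\<close> are offered together, comparing the sums amounts to comparing \<open>a\<close> and \<open>b\<close>.\<close>

lemma val_drift:
  fixes a b v :: nat
  assumes free: "e1 \<notin> R" "e1 \<notin> B" "e2 \<notin> R" "e2 \<notin> B" and "e1 \<noteq> e2"
    and le: "\<Sum>e1 \<le> \<Sum>e2" and v: "a < b" "v \<noteq> a" "v \<noteq> b"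
    and touched: "e1 = {v, a} \<or> e1 = {v, b} \<or> e2 = {v, a} \<or> e2 = {v, b}"
  defines "h \<equiv> \<lambda>R B. val (colour_of R B {v, a}) (colour_of R B {v, b})"
  shows "3/4 * h (insert e1 R) (insert e2 B) + 1/4 * h (insert e2 R) (insert e1 B) \<le> h R B - 1"
proof -
  have ne: "{v, a} \<noteq> {v, b}" using v by (simp add: doubleton_eq_iff)
  \<comment> \<open>This joint offer would average 3/4 * 32 + 1/4 * 0 = 24, above the allowed 10 -
    1; the opposite order averages 8.\<close>
  have wrong: "\<not> (e1 = {v, b} \<and> e2 = {v, a})" using le v by auto
  show ?thesis
    using touched ne wrong free \<open>e1 \<noteq> e2\<close> unfolding h_def
    by (cases "colour_of R B {v, a}"; cases "colour_of R B {v, b}")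
       (auto simp: colour_of_def split: if_splits)
qed

text \<open>At most four summands change, and each has drift at most -1. The exponent is scaled so
  that this drift outweighs the quadratic error of \<open>exp\<close>.\<close>

lemma pair_val_step:
  assumes free: "e1 \<notin> R" "e1 \<notin> B" "e2 \<notin> R" "e2 \<notin> B" and "e1 \<noteq> e2"
    and cards: "card e1 = 2" "card e2 = 2"
    and le: "\<Sum>e1 \<le> \<Sum>e2" and ab: "a < b"
  defines "R1 \<equiv> insert e1 R" and "B1 \<equiv> insert e2 B" and "R2 \<equiv> insert e2 R" and "B2 \<equiv> insert e1 B"
  shows "3/4 * exp (pair_val n R1 B1 a b / 3000000) + 1/4 * exp (pair_val n R2 B2 a b / 3000000)
    \<le> exp (pair_val n R B a b / 3000000)"
proof -
  define h where "h = (\<lambda>v R B. val (colour_of R B {v, a}) (colour_of R B {v, b}))"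
  \<comment> \<open>\<open>T\<close> collects the vertices whose summand the round can change; all
    of them lie in \<open>e1 \<union> e2\<close>.\<close>
  define T where "T = {v \<in> {..<n} - {a, b}.
      e1 = {v, a} \<or> e1 = {v, b} \<or> e2 = {v, a} \<or> e2 = {v, b}}"
  have fT: "finite T" by (simp add: T_def)
  have "T \<subseteq> e1 \<union> e2" by (auto simp: T_def)
  moreover have "finite (e1 \<union> e2)" using cards by (metis card.infinite finite_Un zero_neq_numeral)
  ultimately have "card T \<le> card (e1 \<union> e2)" by (rule card_mono[rotated])
  also have "\<dots> \<le> 4" using card_Un_le[of e1 e2] cards by simp
  finally have cT: "card T \<le> 4" .
  have diff: "pair_val n R' B' a b - pair_val n R B a b = (\<Sum>v\<in>T. h v R' B' - h v R B)"
    if "R' - {e1, e2} = R - {e1, e2}" "B' - {e1, e2} = B - {e1, e2}" for R' B'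
  proof -
    have "pair_val n R' B' a b - pair_val n R B a b =
        (\<Sum>v\<in>{..<n} - {a, b}. h v R' B' - h v R B)"
      by (simp add: pair_val_def h_def sum_subtractf)
    also have "\<dots> = (\<Sum>v\<in>T. h v R' B' - h v R B)"
    proof (rule sum.mono_neutral_right)
      show "\<forall>v\<in>{..<n} - {a, b} - T. h v R' B' - h v R B = 0"
      proof
        fix v assume "v \<in> {..<n} - {a, b} - T"
        then have "e1 \<noteq> {v, a}" "e1 \<noteq> {v, b}" "e2 \<noteq> {v, a}" "e2 \<noteq> {v, b}"
          by (auto simp: T_def)
        then have "colour_of R' B' {v, a} = colour_of R B {v, a}"
          "colour_of R' B' {v, b} = colour_of R B {v, b}"
          by (intro colour_of_cong[OF that]; blast)+
        then show "h v R' B' - h v R B = 0" by (simp add: h_def)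
      qed
    qed (auto simp: T_def)
    finally show ?thesis .
  qed
  define D1 where "D1 = (\<Sum>v\<in>T. h v R1 B1 - h v R B)"
  define D2 where "D2 = (\<Sum>v\<in>T. h v R2 B2 - h v R B)"
  have P1: "pair_val n R1 B1 a b = pair_val n R B a b + D1"
    proof -
    have "R1 - {e1, e2} = R - {e1, e2}" "B1 - {e1, e2} = B - {e1, e2}"
      by (auto simp: R1_def B1_def)
    from diff[OF this] show ?thesis by (simp add: D1_def)
  qed
  have P2: "pair_val n R2 B2 a b = pair_val n R B a b + D2"
    proof -
    have "R2 - {e1, e2} = R - {e1, e2}" "B2 - {e1, e2} = B - {e1, e2}"
      by (auto simp: R2_def B2_def)
    from diff[OF this] show ?thesis by (simp add: D2_def)
  qed
  have bound: "\<bar>\<Sum>v\<in>T. h v R' B' - h v R B\<bar> \<le> 1200" for R' B'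
  proof -
    \<comment> \<open>Values of \<open>val\<close> lie between -256 and 33, so they differ by at
      most 289.\<close>
    have "\<bar>h v R' B' - h v R B\<bar> \<le> 300" for v
      unfolding h_def using val_bounds[of "colour_of R' B' {v, a}" "colour_of R' B' {v, b}"]
        val_bounds[of "colour_of R B {v, a}" "colour_of R B {v, b}"] by linarith
    then have "\<bar>\<Sum>v\<in>T. h v R' B' - h v R B\<bar> \<le> real (card T) * 300"
      by (intro order_trans[OF sum_abs] sum_bounded_above) auto
    with cT show ?thesis by linarith
  qed
  have b1: "\<bar>D1\<bar> \<le> 1200" and b2: "\<bar>D2\<bar> \<le> 1200"
    unfolding D1_def D2_def by (rule bound)+
  have avg: "3/4 * exp (D1 / 3000000) + 1/4 * exp (D2 / 3000000) \<le> 1"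
  proof (cases "T = {}")
    case True
    then show ?thesis by (simp add: D1_def D2_def)
  next
    case False
    have "3/4 * D1 + 1/4 * D2 =
        (\<Sum>v\<in>T. 3/4 * h v R1 B1 + 1/4 * h v R2 B2 - h v R B)"
      unfolding D1_def D2_def sum_distrib_left sum.distrib[symmetric]
      by (intro sum.cong) (auto simp: field_simps)
    also have "\<dots> \<le> (\<Sum>v\<in>T. -1)"
    proof (rule sum_mono)
      fix v assume "v \<in> T"
      then have "3/4 * h v R1 B1 + 1/4 * h v R2 B2 \<le> h v R B - 1"
        unfolding h_def R1_def B1_def R2_def B2_def
        by (intro val_drift free \<open>e1 \<noteq> e2\<close> le ab) (auto simp: T_def)
      then show "3/4 * h v R1 B1 + 1/4 * h v R2 B2 - h v R B \<le> -1" by simp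
    qed
    also have "\<dots> \<le> -1" using False fT by (simp add: Suc_le_eq card_gt_0_iff)
    finally have drift: "3/4 * D1 + 1/4 * D2 \<le> -1" .
    \<comment> \<open>With scale s the error is at most 2 * (1200/s)^2 and the drift gains 1/s, so
      any s of at least 2880000 suffices.\<close>
    have q: "exp (D / 3000000) \<le> 1 + D / 3000000 + 32 / 100000000" if "\<bar>D\<bar> \<le> 1200" for D :: real
    proof -
      have "\<bar>D / 3000000\<bar> \<le> 4 / 10000" using that by simp
      then have "(D / 3000000)\<^sup>2 \<le> (4 / 10000)\<^sup>2" by (metis abs_ge_zero power2_abs power_mono)
      moreover have "exp (D / 3000000) \<le> 1 + D / 3000000 + 2 * (D / 3000000)\<^sup>2"
        using that by (intro exp_le_quadratic) simp
      ultimately show ?thesis by (simp add: power2_eq_square)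
    qed
    show ?thesis using q[OF b1] q[OF b2] drift by (simp add: field_simps)
  qed
  have "3/4 * exp (pair_val n R1 B1 a b / 3000000) + 1/4 * exp (pair_val n R2 B2 a b / 3000000)
      = exp (pair_val n R B a b / 3000000) * (3/4 * exp (D1 / 3000000) + 1/4 * exp (D2 / 3000000))"
    by (simp add: P1 P2 add_divide_distrib exp_add algebra_simps)
  also have "\<dots> \<le> exp (pair_val n R B a b / 3000000)"
    using avg by (simp add: mult_left_le)
  finally show ?thesis .
qed

text \<open>A weighted average of the two outcomes is at most the current potential, so one outcome
  is too. The claim is symmetric in the two edges, hence the smaller sum may be assumed to be at
  \<open>e1\<close>.\<close>

lemma potential_step:
  assumes free: "e1 \<notin> R" "e1 \<notin> B" "e2 \<notin> R" "e2 \<notin> B" and "e1 \<noteq> e2"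
    and cards: "card e1 = 2" "card e2 = 2"
  shows "potential n (insert e1 R) (insert e2 B) \<le> potential n R B
    \<or> potential n (insert e2 R) (insert e1 B) \<le> potential n R B"
  using assms
proof (induction "\<Sum>e1" "\<Sum>e2" arbitrary: e1 e2 rule: linorder_wlog)
  case (le e1 e2)
  have "3/4 * potential n (insert e1 R) (insert e2 B) + 1/4 * potential n (insert e2 R) (insert e1 B)
      \<le> potential n R B"
    unfolding potential_def sum_distrib_left sum.distrib[symmetric]
  proof (rule sum_mono, clarify)
    fix a b assume "(a, b) \<in> vertex_pairs n"
    then show "3/4 * exp (pair_val n (insert e1 R) (insert e2 B) a b / 3000000)
        + 1/4 * exp (pair_val n (insert e2 R) (insert e1 B) a b / 3000000)
      \<le> exp (pair_val n R B a b / 3000000)"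
      using le by (intro pair_val_step) (auto simp: vertex_pairs_def)
  qed
  then show ?case by linarith
next
  case (sym e1 e2)
  then show ?case by blast
qed

section \<open>From the potential to a winning strategy\<close>

lemma card_Kn_edge: "e \<in> Kn_edges n \<Longrightarrow> card e = 2"
  by (auto simp: Kn_edges_def)

lemma finite_Kn_edges: "finite (Kn_edges n)"
  by (rule finite_subset[of _ "Pow {..<n}"]) (auto simp: Kn_edges_def)

text \<open>Client always keeps an edge that does not raise the potential, so the bound
  \<open>K\<close> survives to the end; the induction is on the number of free edges.\<close>

lemma client_wins_if_potential_le:
  assumes "\<And>R B. R \<subseteq> Kn_edges n \<Longrightarrow> potential n R B \<le> K \<Longrightarrow> \<not> P R"
    and "R \<subseteq> Kn_edges n" "potential n R B \<le> K"
  shows "client_wins (Kn_edges n) P R B"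
  using assms(2,3)
proof (induction "card (Kn_edges n - R - B)" arbitrary: R B rule: less_induct)
  case less
  let ?F = "Kn_edges n - R - B"
  have fin: "finite ?F" using finite_Kn_edges by blast
  show ?case
  proof (cases "card ?F \<le> 1")
    case True
    with fin less.prems assms(1) show ?thesis by (intro client_wins.finish)
  next
    case False
    show ?thesis
    proof (rule client_wins.step, use False in simp, intro ballI impI)
      fix e1 e2 assume e: "e1 \<in> ?F" "e2 \<in> ?F" "e1 \<noteq> e2"
      have win: "client_wins (Kn_edges n) P (insert x R) (insert y B)"
        if "x \<in> ?F" "potential n (insert x R) (insert y B) \<le> potential n R B" for x y
      proof (rule less.hyps)
        show "card (Kn_edges n - insert x R - insert y B) < card ?F"
          using that fin by (intro psubset_card_mono) auto
      qed (use that less.prems in auto)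
      have "potential n (insert e1 R) (insert e2 B) \<le> potential n R B
          \<or> potential n (insert e2 R) (insert e1 B) \<le> potential n R B"
        using e card_Kn_edge by (intro potential_step) auto
      with win e show "client_wins (Kn_edges n) P (insert e1 R) (insert e2 B)
          \<or> client_wins (Kn_edges n) P (insert e2 R) (insert e1 B)" by blast
    qed
  qed
qed

section \<open>Two large disjoint red stars\<close>

text \<open>Vertices of \<open>S\<close> contribute at least 0, those of \<open>S'\<close> at least
  32, and the at most \<open>n - 2 * m\<close> others at least -256 each.\<close>

lemma pair_val_stars:
  assumes "a \<noteq> b" "a < n" "b < n"
    and sub: "S \<subseteq> {..<n} - {a, b}" "S' \<subseteq> {..<n} - {a, b}" and disj: "S \<inter> S' = {}"
    and card: "card S = m" "card S' = m"
    and red: "\<And>v. v \<in> S \<Longrightarrow> {v, a} \<in> R" "\<And>v. v \<in> S' \<Longrightarrow> {v, b} \<in> R"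
  shows "544 * real m - 256 * real n \<le> pair_val n R B a b"
proof -
  let ?V = "{..<n} - {a, b}"
  define h where "h = (\<lambda>v. val (colour_of R B {v, a}) (colour_of R B {v, b}))"
  have fin: "finite S" "finite S'" using sub finite_subset by blast+
  have "card ?V \<le> n" using card_mono[of "{..<n}" ?V] by auto
  have "card (?V - (S \<union> S')) = card ?V - 2 * m"
    using sub fin card disj by (subst card_Diff_subset) (auto simp: card_Un_disjoint)
  moreover have "2 * m \<le> card ?V"
    using card_mono[of ?V "S \<union> S'"] sub fin card disj by (simp add: card_Un_disjoint)
  ultimately have rest: "real (card (?V - (S \<union> S'))) \<le> real n - 2 * real m"
    using \<open>card ?V \<le> n\<close> by linarith
  have "pair_val n R B a b = sum h (S \<union> S') + sum h (?V - (S \<union> S'))"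
    unfolding pair_val_def h_def using sub by (subst sum.subset_diff[of "S \<union> S'"]) auto
  also have "sum h (S \<union> S') = sum h S + sum h S'"
    using fin disj by (rule sum.union_disjoint)
  finally have eq: "pair_val n R B a b = sum h S + sum h S' + sum h (?V - (S \<union> S'))" .
  have "0 \<le> sum h S"
    unfolding h_def by (intro sum_nonneg val_Red_left) (simp add: colour_of_def red)
  moreover have "real (card S') * 32 \<le> sum h S'"
    unfolding h_def by (intro sum_bounded_below val_Red_right) (simp add: colour_of_def red)
  moreover have "real (card (?V - (S \<union> S'))) * (-256) \<le> sum h (?V - (S \<union> S'))"
    unfolding h_def by (intro sum_bounded_below val_bounds)
  ultimately show ?thesis using eq rest card by linarith
qed

text \<open>A single term bounds the sum of positive terms from below. Equal star sizes allow
  \<open>a\<close> and \<open>b\<close> to be exchanged, so \<open>a < b\<close> may be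
  assumed.\<close>

lemma potential_stars:
  assumes "a \<noteq> b" "a < n" "b < n"
    and sub: "S \<subseteq> {..<n} - {a, b}" "S' \<subseteq> {..<n} - {a, b}" and disj: "S \<inter> S' = {}"
    and card: "card S = m" "card S' = m"
    and red: "\<And>v. v \<in> S \<Longrightarrow> {v, a} \<in> R" "\<And>v. v \<in> S' \<Longrightarrow> {v, b} \<in> R"
  shows "exp ((544 * real m - 256 * real n) / 3000000) \<le> potential n R B"
  using assms
proof (induction a b arbitrary: S S' rule: linorder_wlog)
  case (le a b)
  have "exp ((544 * real m - 256 * real n) / 3000000) \<le> exp (pair_val n R B a b / 3000000)"
    using pair_val_stars[of a b n S S' m R B] le by simp
  also have "\<dots> = (\<Sum>(a, b)\<in>{(a, b)}. exp (pair_val n R B a b / 3000000))" by simp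
  also have "\<dots> \<le> potential n R B"
    unfolding potential_def using le finite_vertex_pairs
    by (intro sum_mono2) (auto simp: vertex_pairs_def)
  finally show ?case .
next
  case (sym a b)
  show ?case
    by (rule sym(1)[of S' S]) (use sym(2-) in auto)
qed

section \<open>The tree with two centres\<close>

text \<open>Vertices 0 and 1 are the centres with \<open>m\<close> leaves each, starting at 3;
  vertex 2, a neighbour of 0, carries the remainder.\<close>

definition two_star_parent :: "nat \<Rightarrow> nat \<Rightarrow> nat" where
  "two_star_parent m i = (if i < m + 3 then 0 else if i < 2 * m + 3 then 1 else 2)"

lemma potential_two_star_copy:
  assumes copy: "contains_copy R {..<n} (parent_edges (two_star_parent m) n)"
    and R: "R \<subseteq> Kn_edges n" and n: "2 * m + 3 \<le> n"
  shows "exp ((544 * real m - 256 * real n) / 3000000) \<le> potential n R B"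
proof -
  obtain f where inj: "inj_on f {..<n}"
    and edge: "\<And>u v. u < n \<Longrightarrow> v < n \<Longrightarrow> {u, v} \<in> parent_edges (two_star_parent m) n
      \<Longrightarrow> {f u, f v} \<in> R"
    using copy unfolding contains_copy_def by auto
  have red: "{f i, f (two_star_parent m i)} \<in> R" if "1 \<le> i" "i < n" for i
    using that n by (intro edge) (auto simp: parent_edges_def two_star_parent_def)
  have range: "u < n" if "{u, v} \<in> R" for u v
    using that R by (fastforce simp: Kn_edges_def doubleton_eq_iff)
  \<comment> \<open>\<open>contains_copy\<close> does not restrict the range of \<open>f\<close>,
    but every tree vertex lies on an edge, whose image is an edge of \<open>K_n\<close>.\<close>
  have f_less: "f i < n" if "i < n" for i
  proof (cases "i = 0")
    case True
    then show ?thesis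
      using red[of 1] n range[of "f 0" "f 1"] by (simp add: two_star_parent_def insert_commute)
  next
    case False
    then show ?thesis using red[of i] that range by auto
  qed
  have f_eq: "f i = f j \<longleftrightarrow> i = j" if "i < n" "j < n" for i j
    using inj that by (auto simp: inj_on_def)
  have leaf: "f ` I \<subseteq> {..<n} - {f 0, f 1}" if "I \<subseteq> {3..<n}" for I
    using that n by (fastforce simp: f_less f_eq)
  have inj': "inj_on f I" if "I \<subseteq> {3..<n}" for I
    using that by (intro inj_on_subset[OF inj]) auto
  show ?thesis
  proof (rule potential_stars)
    show "f 0 \<noteq> f 1" "f 0 < n" "f 1 < n" using n by (auto simp: f_less f_eq)
    show "f ` {3..<m + 3} \<subseteq> {..<n} - {f 0, f 1}" "f ` {m + 3..<2 * m + 3} \<subseteq> {..<n} - {f 0, f 1}"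
      using n by (intro leaf; auto)+
    show "f ` {3..<m + 3} \<inter> f ` {m + 3..<2 * m + 3} = {}" using n by (auto simp: f_eq)
    show "card (f ` {3..<m + 3}) = m" "card (f ` {m + 3..<2 * m + 3}) = m"
      using n by (subst card_image; auto intro!: inj')+
    show "{v, f 0} \<in> R" if v: "v \<in> f ` {3..<m + 3}" for v
    proof -
      obtain i where "v = f i" "i \<in> {3..<m + 3}" using v by blast
      then show ?thesis using red[of i] n by (simp add: two_star_parent_def)
    qed
    show "{v, f 1} \<in> R" if v: "v \<in> f ` {m + 3..<2 * m + 3}" for v
    proof -
      obtain i where "v = f i" "i \<in> {m + 3..<2 * m + 3}" using v by blast
      then show ?thesis using red[of i] n by (simp add: two_star_parent_def)
    qed
  qed
qed

text \<open>The children of any vertex lie in one of three intervals, of sizes \<open>m + 2\<close>,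
  \<open>m\<close> and \<open>n - (2 * m + 3)\<close>; the parent edge adds one.\<close>

lemma degree_two_star_le:
  assumes "2 * m + 3 \<le> n"
  shows "degree (parent_edges (two_star_parent m) n) v \<le> max (m + 3) (n - 2 * m)"
proof -
  let ?C = "{i \<in> {1..<n}. two_star_parent m i = v}"
  have "?C \<subseteq> {1..<m + 3} \<or> ?C \<subseteq> {m + 3..<2 * m + 3} \<or> ?C \<subseteq> {2 * m + 3..<n}"
    by (cases "v = 0"; cases "v = 1") (auto simp: two_star_parent_def split: if_splits)
  then have "card ?C \<le> m + 2 \<or> card ?C \<le> m \<or> card ?C \<le> n - (2 * m + 3)"
    by (elim disj_forward) (drule card_mono[rotated]; simp)+
  moreover have "degree (parent_edges (two_star_parent m) n) v \<le> Suc (card ?C)"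
    by (rule degree_parent_edges_le) (auto simp: two_star_parent_def)
  ultimately show ?thesis using assms by linarith
qed

theorem theorem1p3:
  shows "\<exists>(c::real) (n0::nat). c > 0 \<and> n0 > 0 \<and>
    (\<forall>n \<ge> n0. \<exists>(VT::nat set) ET. is_tree VT ET \<and> card VT = n
        \<and> (\<forall>v\<in>VT. real (degree ET v) < (1/2 - c) * real n)
        \<and> client_wins_WC n VT ET)"
proof -
  \<comment> \<open>The rate 10 is \<open>val Free Free\<close>, the starting value per vertex; 13
    comes from 544 * 0.495 - 256 = 13.28.\<close>
  have "eventually (\<lambda>n::nat. real n ^ 2 * exp (10 * real n / 3000000)
      < exp ((13 * real n - 1000) / 3000000)) sequentially"
    by real_asymp
  then obtain N where N: "\<And>n. n \<ge> N \<Longrightarrow> real n ^ 2 * exp (10 * real n / 3000000)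
      < exp ((13 * real n - 1000) / 3000000)"
    unfolding eventually_sequentially by blast
  have "\<exists>(VT::nat set) ET. is_tree VT ET \<and> card VT = n
        \<and> (\<forall>v\<in>VT. real (degree ET v) < (1/2 - 1/1000) * real n) \<and> client_wins_WC n VT ET"
    if n: "n \<ge> max N 1000" for n
  proof -
    \<comment> \<open>The ratio m/n must exceed 266/544, about 0.489, to beat the starting
      potential, and stay below 0.499 for the degree bound.\<close>
    define m where "m = 495 * n div 1000"
    have m: "real m \<le> 0.495 * real n" "0.495 * real n - 1 \<le> real m" "2 * m + 3 \<le> n"
    proof -
      have "1000 * m \<le> 495 * n" "495 * n < 1000 * m + 1000"
        unfolding m_def using div_mult_mod_eq[of "495 * n" 1000] mod_less_divisor[of 1000 "495 * n"]
        by linarith+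
      then show "real m \<le> 0.495 * real n" "0.495 * real n - 1 \<le> real m" "2 * m + 3 \<le> n"
        using n by simp_all
    qed
    let ?E = "parent_edges (two_star_parent m) n"
    have "is_tree {..<n} ?E"
      using n by (intro is_tree_parent_edges) (auto simp: two_star_parent_def)
    moreover have "real (degree ?E v) < (1/2 - 1/1000) * real n" for v
    proof -
      have "real (degree ?E v) \<le> max (real m + 3) (real n - 2 * real m)"
        using degree_two_star_le[OF m(3), of v] m(3) by linarith
      also have "\<dots> < (1/2 - 1/1000) * real n" using m n by simp
      finally show ?thesis .
    qed
    moreover have "client_wins_WC n {..<n} ?E"
      unfolding client_wins_WC_def
    proof (rule client_wins_if_potential_le)
      fix R B assume R: "R \<subseteq> Kn_edges n"
        and le: "potential n R B \<le> real n ^ 2 * exp (10 * real n / 3000000)"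
      show "\<not> contains_copy R {..<n} ?E"
      proof
        assume "contains_copy R {..<n} ?E"
        then have "exp ((544 * real m - 256 * real n) / 3000000) \<le> potential n R B"
          using R m(3) by (rule potential_two_star_copy)
        also note le
        also have "real n ^ 2 * exp (10 * real n / 3000000) < exp ((13 * real n - 1000) / 3000000)"
          using N n by simp
        also have "\<dots> \<le> exp ((544 * real m - 256 * real n) / 3000000)" using m by simp
        finally show False by simp
      qed
    qed (use potential_start in auto)
    ultimately show ?thesis by (intro exI[of _ "{..<n}"] exI[of _ ?E]) simp
  qed
  then show ?thesis by (intro exI[of _ "1/1000"] exI[of _ "max N 1000"]) auto
qed

end
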